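(* Let $\mathcal C_1$ and $\mathcal C_2$ be nonempty ray-like closed convex sets, in a finite-dimensional Euclidean space, not containing the origin. Suppose further that $\mathcal C_1\cap\mathcal C_2\neq\emptyset$. Then $$(\mathcal C_1\cap\mathcal C_2)'=\operatorname{cl}\operatorname{conv}(\mathcal C_1'\cup\mathcal C_2'),$$ and both sets are nonempty.
   Context: A set $\mathcal D$ is ray-like if for any $x,y\in\mathcal D$ one has $x+\alpha y\in\mathcal D$ for all $\alpha\ge0$. The antipolar of a set $\mathcal D$ is $\mathcal D'=\{y\mid\langle y,x\rangle\ge1\ \forall x\in\mathcal D\}$. $\operatorname{conv}$ and $\operatorname{cl}$ denote convex hull and closure. *)

theory Defs
  imports "HOL-Analysis.Analysis"
begin

definition ray_like :: "'a::real_vector set \<Rightarrow> bool" where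
  "ray_like D \<longleftrightarrow> (\<forall>x\<in>D. \<forall>y\<in>D. \<forall>\<alpha>\<ge>0. x + \<alpha> *\<^sub>R y \<in> D)"

definition antipolar :: "'a::real_inner set \<Rightarrow> 'a set" where
  "antipolar D = {y. \<forall>x\<in>D. y \<bullet> x \<ge> 1}"

end

theory Submission
  imports Defs
begin

text \<open>
  A closed convex set that is stable under dilations by factors at least 1 and does not contain the
  origin is its own double antipolar. Applied to both sets this gives
  \<open>C1 \<inter> C2 = (C1' \<union> C2')'\<close>, which is also the antipolar of the closed convex hull of
  \<open>C1' \<union> C2'\<close>; the hull again satisfies the hypotheses of the double antipolar theorem, so taking
  antipolars once more yields the claim.
\<close>

lemma mem_antipolar: "y \<in> antipolar D \<longleftrightarrow> (\<forall>x\<in>D. 1 \<le> y \<bullet> x)"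
  by (simp add: antipolar_def)

lemma antipolar_Un: "antipolar (A \<union> B) = antipolar A \<inter> antipolar B"
  by (auto simp: antipolar_def)

text \<open>For fixed \<open>y\<close>, the points \<open>x\<close> with
  \<open>y \<bullet> x \<ge> 1\<close> form a closed convex half-space; once it contains
  \<open>S\<close>, it contains the closed convex hull.\<close>

lemma antipolar_closure_convex_hull:
  "antipolar (closure (convex hull S)) = antipolar S"
proof
  have "S \<subseteq> closure (convex hull S)"
    using hull_subset closure_subset by (rule subset_trans)
  then show "antipolar (closure (convex hull S)) \<subseteq> antipolar S"
    by (auto simp: antipolar_def)
  show "antipolar S \<subseteq> antipolar (closure (convex hull S))"
  proof
    fix y assume "y \<in> antipolar S"
    then have "S \<subseteq> {x. y \<bullet> x \<ge> 1}"
      by (auto simp: antipolar_def)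
    then have "closure (convex hull S) \<subseteq> {x. y \<bullet> x \<ge> 1}"
      by (intro closure_minimal hull_minimal convex_halfspace_ge closed_halfspace_ge)
    then show "y \<in> antipolar (closure (convex hull S))"
      by (auto simp: antipolar_def)
  qed
qed

text \<open>Strict separation of \<open>K\<close> from the origin gives a normal vector with a
  positive bound \<open>b\<close>; dividing by \<open>b\<close> normalises that bound to 1.\<close>

lemma antipolar_nonempty:
  fixes K :: "'a::euclidean_space set"
  assumes "convex K" "closed K" "0 \<notin> K"
  shows "antipolar K \<noteq> {}"
proof -
  obtain a b where "0 < b" and ab: "\<forall>x\<in>K. b < a \<bullet> x"
    using separating_hyperplane_closed_0 [OF assms] by blast
  then have "a /\<^sub>R b \<in> antipolar K"
    by (auto simp: mem_antipolar field_simps intro: less_imp_le)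
  then show ?thesis by blast
qed

lemma ray_like_dilation:
  assumes "ray_like D" "x \<in> D" "1 \<le> t"
  shows "t *\<^sub>R x \<in> D"
proof -
  have "x + (t - 1) *\<^sub>R x \<in> D"
    using assms by (simp add: ray_like_def)
  then show ?thesis by (simp add: algebra_simps)
qed

lemma antipolar_dilation:
  assumes "y \<in> antipolar D" "1 \<le> t"
  shows "t *\<^sub>R y \<in> antipolar D"
  unfolding mem_antipolar
proof
  fix x assume "x \<in> D"
  then have "1 \<le> y \<bullet> x" using assms by (simp add: mem_antipolar)
  then have "1 * 1 \<le> t * (y \<bullet> x)" using assms by (intro mult_mono) auto
  then show "1 \<le> (t *\<^sub>R y) \<bullet> x" by simp
qed

text \<open>Scaling by \<open>t\<close> commutes with both convex hull and closure, so the hull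
  inherits the invariance of \<open>S\<close>.\<close>

lemma closure_convex_hull_dilation:
  fixes S :: "'a::real_normed_vector set"
  assumes "\<And>x. x \<in> S \<Longrightarrow> t *\<^sub>R x \<in> S" "x \<in> closure (convex hull S)"
  shows "t *\<^sub>R x \<in> closure (convex hull S)"
proof -
  have "t *\<^sub>R x \<in> (*\<^sub>R) t ` closure (convex hull S)"
    using assms(2) by blast
  also have "\<dots> = closure (convex hull ((*\<^sub>R) t ` S))"
    by (simp add: closure_scaleR convex_hull_scaling)
  also have "\<dots> \<subseteq> closure (convex hull S)"
    using assms(1) by (intro closure_mono hull_mono) auto
  finally show ?thesis .
qed

lemma nonneg_if_affine_bounded_below:
  fixes c d p :: real
  assumes "\<And>t. 1 \<le> t \<Longrightarrow> c \<le> d + t * p"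
  shows "0 \<le> p"
proof (rule ccontr)
  assume "\<not> 0 \<le> p"
  \<comment> \<open>As \<open>p\<close> is negative, any \<open>t\<close> beyond this quotient
    pushes \<open>d + t * p\<close> down to \<open>c - 1\<close> or lower; the \<open>max\<close>
    keeps \<open>t\<close> admissible.\<close>
  define t where "t = max 1 ((c - d - 1) / p)"
  have "(c - d - 1) / p \<le> t" by (simp add: t_def)
  then have "t * p \<le> c - d - 1"
    using \<open>\<not> 0 \<le> p\<close> by (simp add: neg_divide_le_eq)
  moreover have "c \<le> d + t * p" by (rule assms) (simp add: t_def)
  ultimately show False by simp
qed

text \<open>A point \<open>z\<close> outside \<open>K\<close> is strictly separated from
  \<open>K\<close>, and the separating functional yields an element of the antipolar whose product
  with \<open>z\<close> is below 1. The sign of the offset \<open>b\<close> decides how it is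
  built.\<close>

lemma antipolar_antipolar:
  fixes K :: "'a::euclidean_space set"
  assumes "convex K" "closed K" and ne: "antipolar K \<noteq> {}"
    and dilation: "\<And>x t. x \<in> K \<Longrightarrow> 1 \<le> t \<Longrightarrow> t *\<^sub>R x \<in> K"
  shows "antipolar (antipolar K) = K"
proof
  show "K \<subseteq> antipolar (antipolar K)"
    by (auto simp: antipolar_def inner_commute)
  show "antipolar (antipolar K) \<subseteq> K"
  proof
    fix z assume z: "z \<in> antipolar (antipolar K)"
    show "z \<in> K"
    proof (rule ccontr)
      assume "z \<notin> K"
      then obtain a b where az: "a \<bullet> z < b" and aK: "\<And>x. x \<in> K \<Longrightarrow> b < a \<bullet> x"
        using separating_hyperplane_closed_point [OF assms(1,2)] by blast
      \<comment> \<open>The whole ray \<open>t *\<^sub>R x\<close> with \<open>t \<ge> 1\<close>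
        stays in \<open>K\<close>, where \<open>a\<close> is bounded below by \<open>b\<close>, so
        \<open>a\<close> cannot decrease along it.\<close>
      have a_nonneg: "0 \<le> a \<bullet> x" if "x \<in> K" for x
        using aK [OF dilation [OF that]]
        by (intro nonneg_if_affine_bounded_below [of b 0]) (auto intro: less_imp_le)
      show False
      proof (cases "0 < b")
        \<comment> \<open>Rescaling makes the offset 1: \<open>a /\<^sub>R b\<close> is in the
          antipolar, yet its product with \<open>z\<close> is less than 1.\<close>
        case True
        then have "a /\<^sub>R b \<in> antipolar K"
          using aK by (auto simp: mem_antipolar field_simps intro: less_imp_le)
        then have "1 \<le> z \<bullet> (a /\<^sub>R b)" using z mem_antipolar by blast
        with True az show False by (simp add: inner_commute field_simps)
      next
        \<comment> \<open>Here \<open>a\<close> is a recession direction of the antipolar along which the inner product with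
          \<open>z\<close> strictly decreases.\<close>
        case False
        obtain y where y: "y \<in> antipolar K" using ne by blast
        have "y + t *\<^sub>R a \<in> antipolar K" if "1 \<le> t" for t
          unfolding mem_antipolar
        proof
          fix x assume "x \<in> K"
          with y that a_nonneg have "1 \<le> y \<bullet> x" "0 \<le> t * (a \<bullet> x)"
            by (auto simp: mem_antipolar)
          then show "1 \<le> (y + t *\<^sub>R a) \<bullet> x" by (simp add: inner_add_left)
        qed
        then have "1 \<le> z \<bullet> (y + t *\<^sub>R a)" if "1 \<le> t" for t
          using z that by (simp add: mem_antipolar)
        then have "0 \<le> z \<bullet> a"
          by (intro nonneg_if_affine_bounded_below [of 1 "z \<bullet> y"]) (simp add: inner_add_right)
        with False az show False by (simp add: inner_commute)
      qed
    qed
  qed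
qed

theorem proposition3p7:
  fixes C1 C2 :: "'a::euclidean_space set"
  assumes "C1 \<noteq> {}" and "ray_like C1" and "closed C1" and "convex C1" and "0 \<notin> C1"
    and "C2 \<noteq> {}" and "ray_like C2" and "closed C2" and "convex C2" and "0 \<notin> C2"
    and "C1 \<inter> C2 \<noteq> {}"
  shows "antipolar (C1 \<inter> C2) = closure (convex hull (antipolar C1 \<union> antipolar C2)) \<and>
    antipolar (C1 \<inter> C2) \<noteq> {} \<and>
    closure (convex hull (antipolar C1 \<union> antipolar C2)) \<noteq> {}"
proof -
  let ?S = "antipolar C1 \<union> antipolar C2"
  let ?K = "closure (convex hull ?S)"
  have ne: "antipolar C1 \<noteq> {}" "antipolar C2 \<noteq> {}"
    using assms by (simp_all add: antipolar_nonempty)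
  have "antipolar (antipolar C1) = C1" "antipolar (antipolar C2) = C2"
    using assms ne by (simp_all add: antipolar_antipolar ray_like_dilation)
  then have K: "antipolar ?K = C1 \<inter> C2"
    by (simp add: antipolar_closure_convex_hull antipolar_Un)
  have "antipolar (antipolar ?K) = ?K"
  proof (rule antipolar_antipolar)
    \<comment> \<open>This is where the assumption that \<open>C1\<close> and \<open>C2\<close> meet
      enters.\<close>
    show "antipolar ?K \<noteq> {}" using K assms by simp
    show "t *\<^sub>R x \<in> ?K" if "x \<in> ?K" "1 \<le> t" for x t
      using that by (intro closure_convex_hull_dilation) (auto intro: antipolar_dilation)
  qed (auto intro: convex_closure)
  then have "antipolar (C1 \<inter> C2) = ?K" by (simp add: K)
  moreover have "?K \<noteq> {}" using ne by simp
  ultimately show ?thesis by simp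
qed

end
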